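(* Let $A\in\mathbb{R}^{n\times n}$ be a symmetric matrix with at most $n-2$ zero eigenvalues and whose nonzero eigenvalues are distinct. Then there is an $S\in EM^n_\alpha$, with $\alpha$ in a neighborhood of zero, and a diagonal matrix $D=\operatorname{diag}(d_1,\dots,d_n)$ such that $$A=SDS^T.$$ Furthermore, if $\lambda_1,\dots,\lambda_n$ are the eigenvalues of $A$, then $\sum_{i=1}^n d_i=\sum_{i=1}^n\lambda_i$.
   Context: For $\alpha\in\left(\frac{-1}{n-1},1\right)$, $EM^n_\alpha$ denotes the set of nonsingular real $n\times n$ matrices $S=[s_1,\dots,s_n]$ whose columns satisfy $s_i^Ts_i=1$ and $s_i^Ts_j=\alpha$ for $i\ne j$. All matrices are real. *)

theory Defs
  imports
    "Jordan_Normal_Form.Char_Poly"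
    Complex_Main
begin

text \<open>
  The real eigenvalues, with algebraic multiplicity. For symmetric \<open>A\<close> these are all
  \<open>dim_row A\<close> eigenvalues, and algebraic and geometric multiplicities agree.
\<close>

definition eigvals :: "real mat \<Rightarrow> real multiset" where
  "eigvals A = proots (char_poly A)"

text \<open>
  For \<open>n \<ge> 2\<close>, \<open>EM n \<alpha>\<close> is intended for \<open>\<alpha>\<close> in the open interval from \<open>-1 / (n - 1)\<close> to \<open>1\<close>;
  outside it the set is empty, because the Gram matrix of a nonsingular real matrix is
  positive definite.
\<close>

definition EM :: "nat \<Rightarrow> real \<Rightarrow> real mat set" where
  "EM n \<alpha> = {S \<in> carrier_mat n n. invertible_mat S \<and>
     (\<forall>i<n. col S i \<bullet> col S i = 1) \<and>
     (\<forall>i<n. \<forall>j<n. i \<noteq> j \<longrightarrow> col S i \<bullet> col S j = \<alpha>)}"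

end

theory Submission
  imports Defs
begin

text \<open>
  If \<open>S \<in> EM n \<alpha>\<close> then \<open>transpose_mat S * S\<close> is the matrix \<open>G\<close> with ones on the diagonal and \<open>\<alpha>\<close>
  elsewhere. Conversely, write \<open>G = B * B\<close> with \<open>B\<close> symmetric. If \<open>D\<close> is diagonal and \<open>B * D * B\<close> has
  the characteristic polynomial of \<open>A\<close>, then \<open>A = U * (B * D * B) * transpose_mat U\<close> for an orthogonal
  \<open>U\<close>, and \<open>S = U * B\<close> works. With \<open>e i = (1 - \<alpha>) * d i\<close>, \<open>b = \<alpha> / (1 - \<alpha>)\<close> and
  \<open>p = (\<Prod>i<n. [:- e i, 1:])\<close>, that characteristic polynomial is \<open>(1 + b n) p - b x p'\<close>, by the
  matrix determinant lemma. This operator on polynomials is diagonal in the monomials, so \<open>p\<close> is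
  found coefficientwise. It retains the factor \<open>x ^ k\<close> belonging to the eigenvalue zero, and its
  other factor is a small perturbation of a polynomial with simple real roots; by the intermediate
  value theorem it still splits for small \<open>b\<close>. The statement on the sum of the \<open>d i\<close> compares traces.
\<close>

section \<open>Perturbing polynomials with simple real roots\<close>

lemma prod_linear_monic:
  fixes r :: "'i \<Rightarrow> 'a :: idom"
  assumes "finite Z"
  shows "degree (\<Prod>i\<in>Z. [:- r i, 1:]) = card Z" "coeff (\<Prod>i\<in>Z. [:- r i, 1:]) (card Z) = 1"
proof -
  show d: "degree (\<Prod>i\<in>Z. [:- r i, 1:]) = card Z"
    by (subst degree_prod_sum_eq) auto
  show "coeff (\<Prod>i\<in>Z. [:- r i, 1:]) (card Z) = 1"
    using lead_coeff_prod[of "\<lambda>i. [:- r i, 1:]" Z] d by simp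
qed

text \<open>The limit changes sign across a small interval around each of its simple roots. These
  intervals are disjoint, and the finitely many sign conditions at their endpoints persist under
  pointwise convergence. So \<open>q b\<close> has a root in each interval, which accounts for its
  whole degree.\<close>

lemma eventually_splits_distinct:
  fixes q :: "'b \<Rightarrow> real poly" and Z :: "real set"
  assumes Z: "finite Z"
    and monic: "\<And>b. degree (q b) \<le> card Z" "\<And>b. coeff (q b) (card Z) = 1"
    and lim: "\<And>x. ((\<lambda>b. poly (q b) x) \<longlongrightarrow> poly (\<Prod>r\<in>Z. [:- r, 1:]) x) F"
  shows "\<forall>\<^sub>F b in F. \<exists>Y. finite Y \<and> card Y = card Z \<and> q b = (\<Prod>r\<in>Y. [:- r, 1:])"
proof -
  define R :: "real poly" where "R = (\<Prod>r\<in>Z. [:- r, 1:])"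
  \<comment> \<open>At most half the smallest gap between distinct roots; the inserted
    \<open>1\<close> keeps \<open>Min\<close> away from the empty set when \<open>Z\<close> has
    fewer than two elements.\<close>
  define \<epsilon> where "\<epsilon> = Min (insert 1 ((\<lambda>(r, s). \<bar>r - s\<bar> / 2) ` {(r, s) \<in> Z \<times> Z. r \<noteq> s}))"
  have fin: "finite ((\<lambda>(r, s). \<bar>r - s\<bar> / 2) ` {(r, s) \<in> Z \<times> Z. r \<noteq> s})"
    by (intro finite_imageI finite_subset[OF _ finite_cartesian_product[OF Z Z]]) auto
  have pos: "\<epsilon> > 0"
    unfolding \<epsilon>_def using fin by (subst Min_gr_iff) auto
  have sep: "2 * \<epsilon> \<le> \<bar>r - s\<bar>" if "r \<in> Z" "s \<in> Z" "r \<noteq> s" for r s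
  proof -
    have "\<epsilon> \<le> \<bar>r - s\<bar> / 2"
      unfolding \<epsilon>_def using fin that by (intro Min_le) force+
    thus ?thesis by simp
  qed
  have sign: "poly R (r - \<epsilon>) * poly R (r + \<epsilon>) < 0" if r: "r \<in> Z" for r
  proof -
    \<comment> \<open>Pairing the factors at both endpoints gives
      \<open>(r - s)^2 - \<epsilon>^2\<close>, negative only for \<open>s = r\<close>.\<close>
    have "poly R (r - \<epsilon>) * poly R (r + \<epsilon>) = (\<Prod>s\<in>Z. (r - s)\<^sup>2 - \<epsilon>\<^sup>2)"
      unfolding R_def poly_prod prod.distrib[symmetric]
      by (intro prod.cong) (auto simp: power2_eq_square algebra_simps)
    also have "\<dots> = - \<epsilon>\<^sup>2 * (\<Prod>s\<in>Z - {r}. (r - s)\<^sup>2 - \<epsilon>\<^sup>2)"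
      by (subst prod.remove[OF Z r]) simp
    also have "\<dots> < 0"
    proof -
      have "(\<Prod>s\<in>Z - {r}. (r - s)\<^sup>2 - \<epsilon>\<^sup>2) > 0"
      proof (rule prod_pos)
        fix s assume "s \<in> Z - {r}"
        hence "\<epsilon> < \<bar>r - s\<bar>" using sep[of r s] r pos by auto
        hence "\<epsilon>\<^sup>2 < \<bar>r - s\<bar>\<^sup>2" using pos by (intro power_strict_mono) auto
        thus "0 < (r - s)\<^sup>2 - \<epsilon>\<^sup>2" by simp
      qed
      thus ?thesis using pos by simp
    qed
    finally show ?thesis .
  qed
  have "\<forall>\<^sub>F b in F. \<forall>r\<in>Z. poly (q b) (r - \<epsilon>) * poly (q b) (r + \<epsilon>) < 0"
  proof (intro eventually_ball_finite Z ballI)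
    fix r assume r: "r \<in> Z"
    show "\<forall>\<^sub>F b in F. poly (q b) (r - \<epsilon>) * poly (q b) (r + \<epsilon>) < 0"
      using order_tendstoD(2)[OF tendsto_mult[OF lim lim] sign[OF r, unfolded R_def]] .
  qed
  thus ?thesis
  proof (rule eventually_mono)
    fix b assume b: "\<forall>r\<in>Z. poly (q b) (r - \<epsilon>) * poly (q b) (r + \<epsilon>) < 0"
    have "\<forall>r\<in>Z. \<exists>z>r - \<epsilon>. z < r + \<epsilon> \<and> poly (q b) z = 0"
      using b pos by (intro ballI poly_IVT) auto
    then obtain z where z: "\<And>r. r \<in> Z \<Longrightarrow> z r > r - \<epsilon> \<and> z r < r + \<epsilon> \<and> poly (q b) (z r) = 0"
      by metis
    have inj: "inj_on z Z"
    proof (rule inj_onI, rule ccontr)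
      fix r s assume rs: "r \<in> Z" "s \<in> Z" "z r = z s" "r \<noteq> s"
      show False using sep[OF rs(1,2,4)] z[OF rs(1)] z[OF rs(2)] rs(3) by linarith
    qed
    have card: "card (z ` Z) = card Z" by (rule card_image[OF inj])
    have "q b = (\<Prod>r\<in>z ` Z. [:- r, 1:])"
    \<comment> \<open>Equal coefficients of \<open>x ^ card Z\<close> leave a difference of smaller
      degree, which cannot vanish at \<open>card Z\<close> points without being zero.\<close>
    proof (rule poly_eqI_degree_lead_coeff[where n = "card Z" and A = "z ` Z"])
      show "coeff (q b) (card Z) = coeff (\<Prod>r\<in>z ` Z. [:- r, 1:]) (card Z)"
        using monic(2) prod_linear_monic(2)[of "z ` Z" id] Z card by simp
      show "degree (\<Prod>r\<in>z ` Z. [:- r, 1:]) \<le> card Z"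
        using prod_linear_monic(1)[of "z ` Z" id] Z card by simp
      show "poly (q b) x = poly (\<Prod>r\<in>z ` Z. [:- r, 1:]) x" if "x \<in> z ` Z" for x
        using that z Z by (auto simp: poly_prod)
    qed (use card monic in auto)
    thus "\<exists>Y. finite Y \<and> card Y = card Z \<and> q b = (\<Prod>r\<in>Y. [:- r, 1:])"
      using Z card by blast
  qed
qed

section \<open>Inverting an Euler-type operator on split polynomials\<close>

definition euler_op :: "nat \<Rightarrow> 'a \<Rightarrow> 'a poly \<Rightarrow> 'a :: idom poly" where
  "euler_op n b p = Polynomial.smult (1 + b * of_nat n) p - Polynomial.smult b (pCons 0 (pderiv p))"

text \<open>Monomials are eigenvectors because \<open>x p'\<close> multiplies \<open>x ^ i\<close>
  by \<open>i\<close>. The coefficient of \<open>x ^ n\<close> is fixed, which keeps monic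
  polynomials of degree \<open>n\<close> monic.\<close>

lemma coeff_euler_op:
  "coeff (euler_op n b p) i = (1 + b * (of_nat n - of_nat i)) * coeff p i"
  by (cases i) (auto simp: euler_op_def coeff_pderiv algebra_simps)

text \<open>The eigenvalue on \<open>x ^ i\<close> depends only on \<open>n - i\<close>, so a shift
  of both by \<open>k\<close> cancels. This detaches the possibly multiple root zero, to which the
  sign-change argument does not apply.\<close>

lemma euler_op_monom_mult:
  "euler_op (k + m) b (monom 1 k * p) = monom 1 k * euler_op m b p"
  by (rule poly_eqI) (auto simp: coeff_euler_op coeff_monom_mult)

lemma eventually_euler_op_splits:
  fixes Z :: "real set"
  assumes Z: "finite Z"
  shows "\<forall>\<^sub>F b in nhds 0. \<exists>Y. finite Y \<and> card Y = card Z \<and>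
    euler_op (card Z) b (\<Prod>r\<in>Y. [:- r, 1:]) = (\<Prod>r\<in>Z. [:- r, 1:])"
proof -
  define m where "m = card Z"
  define R :: "real poly" where "R = (\<Prod>r\<in>Z. [:- r, 1:])"
  \<comment> \<open>The coefficientwise preimage of \<open>R\<close> under
    \<open>euler_op m b\<close>. A zero denominator would give the junk quotient \<open>0\<close>;
    such \<open>b\<close> are excluded below.\<close>
  define q where "q b = (\<Sum>i\<le>m. monom (coeff R i / (1 + b * (real m - real i))) i)" for b
  have R: "degree R = m" "coeff R m = 1"
    using prod_linear_monic[OF Z, of "\<lambda>r. r"] by (auto simp: R_def m_def)
  have coeff_q: "coeff (q b) i = (if i \<le> m then coeff R i / (1 + b * (real m - real i)) else 0)" for b i
    by (simp add: q_def coeff_sum)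
  have "((\<lambda>b. poly (q b) x) \<longlongrightarrow> (\<Sum>i\<le>m. coeff R i / (1 + 0 * (real m - real i)) * x ^ i)) (nhds 0)" for x
    unfolding q_def poly_sum poly_monom by (intro tendsto_intros) (auto intro: filterlim_ident)
  hence lim: "((\<lambda>b. poly (q b) x) \<longlongrightarrow> poly R x) (nhds 0)" for x
    by (simp add: poly_altdef R)
  have "\<forall>\<^sub>F b in nhds 0. \<exists>Y. finite Y \<and> card Y = card Z \<and> q b = (\<Prod>r\<in>Y. [:- r, 1:])"
  proof (rule eventually_splits_distinct[OF Z])
    show "degree (q b) \<le> card Z" for b
      by (rule degree_le) (auto simp: coeff_q m_def)
    show "coeff (q b) (card Z) = 1" for b
      using R by (simp add: coeff_q flip: m_def)
  qed (use lim in \<open>simp add: R_def\<close>)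
  moreover have "\<forall>\<^sub>F b in nhds 0. \<forall>i\<in>{..m}. 1 + b * (real m - real i) \<noteq> 0"
  proof (intro eventually_ball_finite ballI)
    fix i
    have "((\<lambda>b. 1 + b * (real m - real i)) \<longlongrightarrow> 1 + 0 * (real m - real i)) (nhds 0)"
      by (intro tendsto_intros) (auto intro: filterlim_ident)
    thus "\<forall>\<^sub>F b in nhds 0. 1 + b * (real m - real i) \<noteq> 0"
      by (rule tendsto_imp_eventually_ne) simp
  qed simp
  ultimately show ?thesis
  proof eventually_elim
    case (elim b)
    from elim(1) obtain Y where Y: "finite Y" "card Y = card Z" "q b = (\<Prod>r\<in>Y. [:- r, 1:])"
      by blast
    have "euler_op m b (q b) = R"
    proof (rule poly_eqI)
      fix i
      show "coeff (euler_op m b (q b)) i = coeff R i"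
        using elim(2) R(1) by (cases "i \<le> m") (auto simp: coeff_euler_op coeff_q coeff_eq_0)
    qed
    thus ?case using Y unfolding m_def R_def by metis
  qed
qed

lemma prod_linear_finite_set_as_indexed:
  fixes Y :: "'a :: {linorder, idom} set"
  assumes "finite Y"
  obtains e where "monom 1 k * (\<Prod>r\<in>Y. [:- r, 1:]) = (\<Prod>i<k + card Y. [:- e i, 1:])"
proof -
  obtain f where f: "bij_betw f {..<card Y} Y"
    using ex_bij_betw_nat_finite[OF assms] by (auto simp: atLeast0LessThan)
  define e where "e i = (if i < k then 0 else f (i - k))" for i
  have "(\<Prod>i<k + m. [:- e i, 1:]) = (\<Prod>i<k. [:- e i, 1:]) * (\<Prod>i<m. [:- e (k + i), 1:])" for m
    by (induction m) (simp_all add: mult_ac del: mult_pCons_left mult_pCons_right)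
  hence "(\<Prod>i<k + card Y. [:- e i, 1:]) = (\<Prod>i<k. [:- e i, 1:]) * (\<Prod>i<card Y. [:- e (k + i), 1:])" .
  also have "(\<Prod>i<k. [:- e i, 1:]) = monom 1 k"
    by (simp add: e_def monom_altdef)
  also have "(\<Prod>i<card Y. [:- e (k + i), 1:]) = (\<Prod>r\<in>Y. [:- r, 1:])"
    using prod.reindex_bij_betw[OF f, of "\<lambda>r. [:- r, 1:]"] by (simp add: e_def)
  finally show ?thesis using that by metis
qed

lemma eventually_euler_op_preimage:
  fixes P :: "real poly"
  assumes P: "P = monom 1 k * (\<Prod>r\<in>Z. [:- r, 1:])" and Z: "finite Z" and n: "k + card Z = n"
  shows "\<forall>\<^sub>F b in nhds 0. \<exists>e. euler_op n b (\<Prod>i<n. [:- e i, 1:]) = P"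
  using eventually_euler_op_splits[OF Z]
proof eventually_elim
  case (elim b)
  then obtain Y where Y: "finite Y" "card Y = card Z"
    "euler_op (card Z) b (\<Prod>r\<in>Y. [:- r, 1:]) = (\<Prod>r\<in>Z. [:- r, 1:])" by blast
  obtain e where "monom 1 k * (\<Prod>r\<in>Y. [:- r, 1:]) = (\<Prod>i<n. [:- e i, 1:])"
    using prod_linear_finite_set_as_indexed[OF Y(1), of k] n Y(2) by metis
  hence "euler_op n b (\<Prod>i<n. [:- e i, 1:]) = euler_op n b (monom 1 k * (\<Prod>r\<in>Y. [:- r, 1:]))"
    by simp
  also have "\<dots> = P"
    unfolding P Y(3)[symmetric] n[symmetric] by (rule euler_op_monom_mult)
  finally show ?case by blast
qed

section \<open>Orthogonal diagonalization of real symmetric matrices\<close>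

text \<open>\<open>H\<close> is the reflection along \<open>w = v - unit_vec n 0\<close>, which
  swaps these two unit vectors. It serves as an orthogonal matrix with prescribed first column that
  is its own transpose and inverse.\<close>

lemma householder_reflection:
  fixes v :: "real vec"
  assumes v: "v \<in> carrier_vec n" and unit: "v \<bullet> v = 1" and n: "n > 0"
  obtains H where "H \<in> carrier_mat n n" "transpose_mat H = H" "H * H = 1\<^sub>m n"
    "H *\<^sub>v unit_vec n 0 = v"
proof -
  define w where "w i = v $ i - (if i = 0 then 1 else 0)" for i
  define N where "N = (\<Sum>i<n. w i * w i)"
  \<comment> \<open>If \<open>N = 0\<close>, then \<open>w\<close> vanishes below \<open>n\<close>, and the junk value \<open>c = 0\<close> is harmless.\<close>
  define c where "c = 2 / N"
  define H where "H = mat n n (\<lambda>(i, j). (if i = j then 1 else 0) - c * w i * w j)"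
  have v2: "(\<Sum>i<n. v $ i * v $ i) = 1"
    using unit v by (simp add: scalar_prod_def atLeast0LessThan)
  have "N = (\<Sum>i<n. v $ i * v $ i) - 2 * (\<Sum>i<n. if i = 0 then v $ i else 0) + (\<Sum>i<n. if i = 0 then 1 else 0)"
    unfolding N_def w_def sum_distrib_left sum_subtractf[symmetric] sum.distrib[symmetric]
    by (intro sum.cong) (auto simp: algebra_simps)
  also have "\<dots> = 2 - 2 * v $ 0"
    using n v2 by (simp add: sum.delta)
  finally have N: "N = 2 - 2 * v $ 0" .
  have cw: "c * N * w i = 2 * w i" if "i < n" for i
  proof (cases "N = 0")
    case True
    hence "w i * w i = 0"
      unfolding N_def using that by (subst (asm) sum_nonneg_eq_0_iff) auto
    thus ?thesis by simp
  qed (simp add: c_def)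
  show thesis
  proof
    show H: "H \<in> carrier_mat n n" "transpose_mat H = H"
      by (auto simp: H_def intro!: eq_matI)
    show "H * H = 1\<^sub>m n"
    proof (rule eq_matI)
      fix i j assume "i < dim_row (1\<^sub>m n :: real mat)" "j < dim_col (1\<^sub>m n :: real mat)"
      hence ij: "i < n" "j < n" by auto
      have "(H * H) $$ (i, j) = (\<Sum>k<n. ((if i = k then 1 else 0) - c * w i * w k) *
          ((if k = j then 1 else 0) - c * w k * w j))"
        using ij by (simp add: H_def scalar_prod_def atLeast0LessThan)
      also have "\<dots> = (\<Sum>k<n. if i = k then (if k = j then 1 else 0) - c * w k * w j else 0)
          - (\<Sum>k<n. if k = j then c * w i * w k else 0) + (\<Sum>k<n. c * c * w i * w j * (w k * w k))"
        unfolding sum_subtractf[symmetric] sum.distrib[symmetric]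
        by (intro sum.cong) (auto simp: algebra_simps)
      also have "\<dots> = (if i = j then 1 else 0) - 2 * c * w i * w j + c * (c * N * w i) * w j"
        using ij by (simp add: N_def sum.delta sum.delta' sum_distrib_left[symmetric])
      also have "\<dots> = (1\<^sub>m n :: real mat) $$ (i, j)"
        using ij cw[of i] by simp
      finally show "(H * H) $$ (i, j) = (1\<^sub>m n :: real mat) $$ (i, j)" .
    qed (simp_all add: H_def)
    show "H *\<^sub>v unit_vec n 0 = v"
    proof (rule eq_vecI)
      fix i assume "i < dim_vec v"
      hence i: "i < n" using v by auto
      have "(H *\<^sub>v unit_vec n 0) $ i = H $$ (i, 0)"
        using i n H(1) by simp
      \<comment> \<open>Here \<open>w 0 = v $ 0 - 1 = - N / 2\<close>, so column \<open>0\<close> of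
        \<open>H\<close> is the unit vector plus \<open>c * N / 2\<close> times
        \<open>w\<close>.\<close>
      also have "\<dots> = (if i = 0 then 1 else 0) + (c * N * w i) / 2"
        using i n by (simp add: H_def N) (simp add: w_def algebra_simps)
      also have "\<dots> = v $ i"
        using cw[OF i] by (simp add: w_def field_simps)
      finally show "(H *\<^sub>v unit_vec n 0) $ i = v $ i" .
    qed (use H(1) v in auto)
  qed
qed

text \<open>Deflation: a reflection moves a unit eigenvector to the first coordinate, and induction
  treats the remaining block. The order of the roots is prescribed by \<open>e\<close>, so that two
  symmetric matrices with the same characteristic polynomial receive the same diagonal
  factor.\<close>

lemma orthogonal_diagonalization:
  fixes A :: "real mat"
  assumes "A \<in> carrier_mat n n" "transpose_mat A = A"
    and "char_poly A = (\<Prod>i<n. [:- e i, 1:])"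
  shows "\<exists>P\<in>carrier_mat n n. transpose_mat P * P = 1\<^sub>m n \<and> A = P * mat_diag n e * transpose_mat P"
  using assms
proof (induction n arbitrary: A e)
  case 0
  thus ?case by (intro bexI[of _ "1\<^sub>m 0"]) (auto intro!: eq_matI)
next
  case (Suc n A e)
  let ?n = "Suc n"
  note A = Suc.prems(1) and sym = Suc.prems(2) and cp = Suc.prems(3)
  have "poly (char_poly A) (e 0) = 0"
    unfolding cp poly_prod by (subst prod_zero_iff) (auto intro!: bexI[of _ 0])
  hence "eigenvalue A (e 0)"
    using eigenvalue_root_char_poly[OF A] by simp
  then obtain x where x: "x \<in> carrier_vec ?n" "x \<noteq> 0\<^sub>v ?n" "A *\<^sub>v x = e 0 \<cdot>\<^sub>v x"
    using A unfolding eigenvalue_def eigenvector_def by auto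
  have xx: "x \<bullet> x > 0"
    using conjugate_square_greater_0_vec[OF x(1)] x(2) by simp
  define v where "v = (1 / sqrt (x \<bullet> x)) \<cdot>\<^sub>v x"
  have v: "v \<in> carrier_vec ?n" and Av: "A *\<^sub>v v = e 0 \<cdot>\<^sub>v v"
    using x A by (auto simp: v_def mult_mat_vec smult_smult_assoc mult.commute)
  have "v \<bullet> v = 1"
    using x(1) xx by (simp add: v_def)
  then obtain H where H: "H \<in> carrier_mat ?n ?n" "transpose_mat H = H" "H * H = 1\<^sub>m ?n"
    "H *\<^sub>v unit_vec ?n 0 = v"
    using householder_reflection[OF v] by blast
  define M where "M = H * A * H"
  have M: "M \<in> carrier_mat ?n ?n" using H A by (auto simp: M_def)
  have Msym: "transpose_mat M = M"
    using H A sym by (simp add: M_def transpose_mult[of _ ?n ?n _ ?n] assoc_mult_mat[of _ ?n ?n _ ?n _ ?n])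
  have HHX: "H * (H * X) = X" if "X \<in> carrier_mat ?n ?n" for X
    using H(1,3) that by (simp flip: assoc_mult_mat[of _ ?n ?n _ ?n _ ?n])
  have AM: "A = H * M * H"
    unfolding M_def using H A by (simp add: assoc_mult_mat[of _ ?n ?n _ ?n _ ?n] HHX)
  have "M *\<^sub>v unit_vec ?n 0 = H *\<^sub>v (A *\<^sub>v (H *\<^sub>v unit_vec ?n 0))"
    unfolding M_def using H A by (simp add: assoc_mult_mat_vec[of _ ?n ?n _ ?n])
  also have "\<dots> = e 0 \<cdot>\<^sub>v (H *\<^sub>v v)"
    using H v by (simp add: Av mult_mat_vec)
  also have "H *\<^sub>v v = (H * H) *\<^sub>v unit_vec ?n 0"
    unfolding H(4)[symmetric] using H(1) by (simp add: assoc_mult_mat_vec[of _ ?n ?n _ ?n])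
  also have "\<dots> = unit_vec ?n 0"
    unfolding H(3) by simp
  finally have Mu: "M *\<^sub>v unit_vec ?n 0 = e 0 \<cdot>\<^sub>v unit_vec ?n 0" .
  \<comment> \<open>The first column comes from the eigenvector equation and the first row from
    symmetry, so \<open>M\<close> is block diagonal.\<close>
  have M0: "M $$ (i, 0) = (if i = 0 then e 0 else 0)" if "i < ?n" for i
    using arg_cong[OF Mu, of "\<lambda>y. y $ i"] that M by simp
  have M0': "M $$ (0, i) = (if i = 0 then e 0 else 0)" if "i < ?n" for i
    using M0[OF that] that M index_transpose_mat(1)[of i M 0] Msym by auto
  define A' where "A' = mat n n (\<lambda>(i, j). M $$ (Suc i, Suc j))"
  have A': "A' \<in> carrier_mat n n" by (simp add: A'_def)
  have M_block: "M = four_block_mat (mat 1 1 (\<lambda>_. e 0)) (0\<^sub>m 1 n) (0\<^sub>m n 1) A'"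
    using M M0 M0' by (intro eq_matI) (auto simp: A'_def)
  have "A' $$ (j, i) = A' $$ (i, j)" if "i < n" "j < n" for i j
    using that M Msym index_transpose_mat(1)[of "Suc i" M "Suc j"] by (auto simp: A'_def)
  hence A'sym: "transpose_mat A' = A'"
    using A' by (intro eq_matI) auto
  have "char_poly A = char_poly M"
    by (rule char_poly_similar, rule similar_matI[of _ _ H H ?n]) (use A M H AM in auto)
  also have "\<dots> = char_poly (mat 1 1 (\<lambda>_. e 0)) * char_poly A'"
    unfolding M_block by (rule char_poly_four_block_zeros_col[of _ _ n]) (use A' in auto)
  also have "char_poly (mat 1 1 (\<lambda>_. e 0)) = [:- e 0, 1:]"
    by (subst char_poly_upper_triangular[of _ 1]) (auto simp: diag_mat_def upper_triangular_def)
  \<comment> \<open>Cancelling the factor for \<open>e 0\<close> leaves the other roots, with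
    indices shifted by one, for the induction hypothesis.\<close>
  finally have "[:- e 0, 1:] * (\<Prod>i<n. [:- e (Suc i), 1:]) = [:- e 0, 1:] * char_poly A'"
    unfolding cp prod.lessThan_Suc_shift by simp
  hence "char_poly A' = (\<Prod>i<n. [:- e (Suc i), 1:])"
    by (subst (asm) mult_left_cancel) auto
  from Suc.IH[OF A' A'sym this] obtain P' where P': "P' \<in> carrier_mat n n"
    "transpose_mat P' * P' = 1\<^sub>m n" "A' = P' * mat_diag n (\<lambda>i. e (Suc i)) * transpose_mat P'" by blast
  define F where "F = four_block_mat (1\<^sub>m 1) (0\<^sub>m 1 n) (0\<^sub>m n 1) P'"
  have F: "F \<in> carrier_mat ?n ?n"
    unfolding F_def using four_block_carrier_mat[of "1\<^sub>m 1" 1 1 P' n n] P' by auto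
  have FT: "transpose_mat F = four_block_mat (1\<^sub>m 1) (0\<^sub>m 1 n) (0\<^sub>m n 1) (transpose_mat P')"
    unfolding F_def by (subst transpose_four_block_mat[of _ 1 1 _ n _ n]) (use P' in auto)
  have FF: "transpose_mat F * F = 1\<^sub>m ?n"
    unfolding FT unfolding F_def
    by (subst mult_four_block_mat[of _ 1 1 _ n _ n _ _ 1 _ n]) (use P' in \<open>auto intro!: eq_matI\<close>)
  have diag: "mat_diag ?n e = four_block_mat (mat 1 1 (\<lambda>_. e 0)) (0\<^sub>m 1 n) (0\<^sub>m n 1) (mat_diag n (\<lambda>i. e (Suc i)))"
    by (rule eq_matI) (auto simp: mat_diag_def)
  have "F * mat_diag ?n e = four_block_mat (mat 1 1 (\<lambda>_. e 0)) (0\<^sub>m 1 n) (0\<^sub>m n 1) (P' * mat_diag n (\<lambda>i. e (Suc i)))"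
    unfolding F_def diag using P'(1)
    by (simp add: left_mult_zero_mat[OF mat_diag_dim] mult_four_block_mat[of _ 1 1 _ n _ n _ _ 1 _ n])
  moreover have "P' * mat_diag n (\<lambda>i. e (Suc i)) \<in> carrier_mat n n"
      "P' * mat_diag n (\<lambda>i. e (Suc i)) * transpose_mat P' \<in> carrier_mat n n"
    using P'(1) by (auto intro!: mult_carrier_mat[of _ n n])
  ultimately have MF: "M = F * mat_diag ?n e * transpose_mat F"
    unfolding M_block FT P'(3) using P'(1)
    by (simp add: right_mult_zero_mat[of _ n n] left_add_zero_mat[of _ n n] mult_four_block_mat[of _ 1 1 _ n _ n _ _ 1 _ n])
  show ?case
  proof (intro bexI conjI)
    show HF: "H * F \<in> carrier_mat ?n ?n" using H F by auto
    have T: "transpose_mat (H * F) = transpose_mat F * H"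
      using H F by (simp add: transpose_mult[of _ ?n ?n _ ?n])
    have "transpose_mat (H * F) * (H * F) = transpose_mat F * (H * H) * F"
      unfolding T using H(1) F by (simp add: assoc_mult_mat[of _ ?n ?n _ ?n _ ?n])
    thus "transpose_mat (H * F) * (H * F) = 1\<^sub>m ?n" using H F FF by simp
    show "A = H * F * mat_diag ?n e * transpose_mat (H * F)"
      unfolding T by (subst AM, subst MF)
        (use H(1) F mat_diag_dim[of ?n e] in \<open>simp add: assoc_mult_mat[of _ ?n ?n _ ?n _ ?n] del: mat_diag_dim\<close>)
  qed
qed

text \<open>The polynomial splits over the complex numbers, and its roots are real because a real
  symmetric matrix is Hermitian.\<close>

lemma symmetric_char_poly_splits:
  fixes A :: "real mat"
  assumes A: "A \<in> carrier_mat n n" and sym: "transpose_mat A = A"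
  shows "\<exists>e. char_poly A = (\<Prod>i<n. [:- e i, 1:])"
proof -
  let ?h = "complex_of_real"
  let ?C = "map_mat ?h A"
  interpret h: map_poly_inj_idom_hom ?h ..
  have C: "?C \<in> carrier_mat n n" using A by simp
  obtain as where as: "char_poly ?C = (\<Prod>a\<leftarrow>as. [:- a, 1:])" "length as = n"
    using char_poly_factorized[OF C] by blast
  have real: "a \<in> \<real>" if "a \<in> set as" for a
  proof -
    have "poly (char_poly ?C) a = 0"
      unfolding as poly_prod_list using that by (auto simp: prod_list_zero_iff)
    hence "eigenvalue ?C a" using eigenvalue_root_char_poly[OF C] by simp
    then obtain x where x: "x \<in> carrier_vec n" "x \<noteq> 0\<^sub>v n" "?C *\<^sub>v x = a \<cdot>\<^sub>v x"
      using A unfolding eigenvalue_def eigenvector_def by auto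
    have row: "(\<Sum>j<n. ?h (A $$ (i, j)) * x $ j) = a * x $ i" if "i < n" for i
      using arg_cong[OF x(3), of "\<lambda>y. y $ i"] that A x(1)
      by (simp add: scalar_prod_def atLeast0LessThan)
    have Asym: "A $$ (i, j) = A $$ (j, i)" if "i < n" "j < n" for i j
      using that A sym index_transpose_mat(1)[of j A i] by auto
    define s where "s = (\<Sum>i<n. cnj (x $ i) * x $ i)"
    \<comment> \<open>The Hermitian form of \<open>A\<close> at \<open>x\<close> is evaluated twice:
      applying \<open>A\<close> to \<open>x\<close> gives \<open>a * s\<close>, and applying it to
      the conjugate of \<open>x\<close> by symmetry gives \<open>cnj a * s\<close>.\<close>
    have "a * s = (\<Sum>i<n. \<Sum>j<n. cnj (x $ i) * ?h (A $$ (i, j)) * x $ j)"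
      unfolding s_def sum_distrib_left
    proof (intro sum.cong refl)
      fix i assume "i \<in> {..<n}"
      thus "a * (cnj (x $ i) * x $ i) = (\<Sum>j<n. cnj (x $ i) * ?h (A $$ (i, j)) * x $ j)"
        using row[of i] by (simp add: mult.assoc mult.left_commute flip: sum_distrib_left)
    qed
    also have "\<dots> = (\<Sum>j<n. \<Sum>i<n. cnj (x $ i) * ?h (A $$ (j, i)) * x $ j)"
      by (subst sum.swap) (auto intro!: sum.cong simp: Asym)
    also have "\<dots> = (\<Sum>j<n. cnj (a * x $ j) * x $ j)"
      by (intro sum.cong) (auto simp: row[symmetric] sum_distrib_left sum_distrib_right mult_ac)
    also have "\<dots> = cnj a * s"
      by (simp add: s_def sum_distrib_left mult.assoc)
    finally have *: "a * s = cnj a * s" .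
    have "s = x \<bullet>c x"
      using x(1) by (simp add: s_def scalar_prod_def atLeast0LessThan mult.commute)
    hence "s \<noteq> 0" using x by (simp add: conjugate_square_eq_0_vec)
    with * have "a = cnj a" by simp
    thus ?thesis by (metis Reals_cnj_iff)
  qed
  have "map_poly ?h (char_poly A) = map_poly ?h (\<Prod>a\<leftarrow>as. [:- Re a, 1:])"
    unfolding of_real_hom.char_poly_hom[OF A, symmetric] as(1) using real
    by (induction as) (auto simp: h.hom_mult hom_distribs simp del: mult_pCons_left)
  hence "char_poly A = (\<Prod>a\<leftarrow>as. [:- Re a, 1:])"
    by (simp add: h.eq_iff)
  also have "\<dots> = (\<Prod>i<n. [:- Re (as ! i), 1:])"
    by (simp add: prod.list_conv_set_nth as(2) atLeast0LessThan)
  finally show ?thesis by (intro exI[of _ "\<lambda>i. Re (as ! i)"]) 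
qed

section \<open>Matrices with equiangular columns\<close>

lemma det_one_plus_rank_one:
  fixes u v :: "'a :: idom mat"
  assumes u: "u \<in> carrier_mat n 1" and v: "v \<in> carrier_mat 1 n"
  shows "det (1\<^sub>m n + u * v) = 1 + (v * u) $$ (0, 0)"
proof -
  \<comment> \<open>Eliminating either off-diagonal block of \<open>X\<close> computes its determinant in two ways.\<close>
  define X where "X = four_block_mat (1\<^sub>m n) (- u) v (1\<^sub>m 1)"
  define Y where "Y = four_block_mat (1\<^sub>m n) u (0\<^sub>m 1 n) (1\<^sub>m 1)"
  define Z where "Z = four_block_mat (1\<^sub>m n) (0\<^sub>m n 1) (- v) (1\<^sub>m 1)"
  have X: "X \<in> carrier_mat (n + 1) (n + 1)" and Y: "Y \<in> carrier_mat (n + 1) (n + 1)"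
    and Z: "Z \<in> carrier_mat (n + 1) (n + 1)"
    unfolding X_def Y_def Z_def by (auto intro!: four_block_carrier_mat)
  have "X * Y = four_block_mat (1\<^sub>m n) (0\<^sub>m n 1) v (v * u + 1\<^sub>m 1)"
    unfolding X_def Y_def
    by (subst mult_four_block_mat[of _ n n _ 1 _ 1 _ _ n _ 1]) (use u v in \<open>auto simp: uminus_l_inv_mat\<close>)
  hence "det (X * Y) = det (v * u + 1\<^sub>m 1)"
    using u v by (simp add: det_four_block_mat_upper_right_zero[of _ n _ 1])
  also have "\<dots> = (v * u) $$ (0, 0) + 1"
    using u v by (subst det_single) auto
  finally have XY: "det (X * Y) = (v * u) $$ (0, 0) + 1" .
  have uv: "(- u) * (- v) = u * v"
    using u v by (intro eq_matI) (auto simp: scalar_prod_def)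
  have "X * Z = four_block_mat (1\<^sub>m n + u * v) (- u) (0\<^sub>m 1 n) (1\<^sub>m 1)"
    unfolding X_def Z_def
    by (subst mult_four_block_mat[of _ n n _ 1 _ 1 _ _ n _ 1]) (use u v uv in auto)
  hence "det (X * Z) = det (1\<^sub>m n + u * v)"
    using u v by (simp add: det_four_block_mat_lower_left_zero[of _ n _ 1])
  moreover have "det Y = 1" "det Z = 1"
    unfolding Y_def Z_def using u v
    by (simp_all add: det_four_block_mat_lower_left_zero[of _ n _ 1] det_four_block_mat_upper_right_zero[of _ n _ 1])
  ultimately show ?thesis
    using XY det_mult[OF X Y] det_mult[OF X Z] by simp
qed

lemma det_mat_diag: "det (mat_diag n f) = (\<Prod>i<n. f i)"
  by (subst det_upper_triangular[of _ n])
    (auto simp: mat_diag_def upper_triangular_def prod_list_diag_prod atLeast0LessThan)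

text \<open>For \<open>x\<close> different from all \<open>e i\<close>, \<open>x I - ?N\<close> is
  an invertible diagonal matrix times a rank-one update of the identity. Both sides are polynomials
  in \<open>x\<close>, so agreement off a finite set suffices.\<close>

lemma char_poly_diag_mult_one_plus_const:
  fixes e :: "nat \<Rightarrow> real"
  shows "char_poly (mat n n (\<lambda>(i, j). e i * ((if i = j then 1 else 0) + b)))
    = euler_op n b (\<Prod>i<n. [:- e i, 1:])" (is "char_poly ?N = euler_op n b ?p")
proof -
  have pt: "poly (char_poly ?N) x = poly (euler_op n b ?p) x" if x: "x \<notin> e ` {..<n}" for x
  proof -
    have ne: "x - e i \<noteq> 0" if "i < n" for i using x that by auto
    \<comment> \<open>Row \<open>i\<close> of \<open>x I - ?N\<close> is the diagonal row with
      \<open>b * e i\<close> subtracted from every entry; taking out the factor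
      \<open>x - e i\<close> turns that constant into \<open>w i\<close>.\<close>
    define w where "w i = - b * e i / (x - e i)" for i
    have w: "e i * w i = b * e i + x * w i" if "i < n" for i
      using ne[OF that] by (simp add: w_def divide_simps) (simp add: algebra_simps)
    define u where "u = mat n 1 (\<lambda>(i, j). w i)"
    define v :: "real mat" where "v = mat 1 n (\<lambda>_. 1)"
    have uv: "u \<in> carrier_mat n 1" "v \<in> carrier_mat 1 n" by (auto simp: u_def v_def)
    have "- char_matrix ?N x = mat_diag n (\<lambda>i. x - e i) * (1\<^sub>m n + u * v)"
      by (subst mat_diag_mult_left[of _ n n])
        (auto intro!: eq_matI simp: char_matrix_def u_def v_def scalar_prod_def distrib_left w algebra_simps)
    hence "poly (char_poly ?N) x = det (mat_diag n (\<lambda>i. x - e i)) * det (1\<^sub>m n + u * v)"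
      using uv by (subst char_poly_matrix[of _ n]) (auto simp: det_mult[of _ n])
    also have "\<dots> = (\<Prod>i<n. x - e i) * (1 - b * (\<Sum>i<n. e i / (x - e i)))"
      unfolding det_mat_diag det_one_plus_rank_one[OF uv]
      by (simp add: u_def v_def w_def scalar_prod_def atLeast0LessThan sum_distrib_left sum_negf)
    \<comment> \<open>Splitting off \<open>-1\<close> from each term brings in the logarithmic
      derivative of \<open>?p\<close>.\<close>
    also have "(\<Sum>i<n. e i / (x - e i)) = (\<Sum>i<n. x * (1 / (x - e i)) - 1)"
      using ne by (intro sum.cong) (auto simp: field_simps)
    also have "\<dots> = x * (\<Sum>i<n. 1 / (x - e i)) - n"
      by (simp add: sum_subtractf sum_distrib_left)
    finally have L: "poly (char_poly ?N) x =
        (\<Prod>i<n. x - e i) * (1 - b * (x * (\<Sum>i<n. 1 / (x - e i)) - n))" .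
    have "poly (pderiv ?p) x = (\<Sum>i<n. \<Prod>j\<in>{..<n} - {i}. x - e j)"
      by (simp add: pderiv_prod poly_sum poly_prod pderiv_pCons)
    also have "\<dots> = (\<Prod>i<n. x - e i) * (\<Sum>i<n. 1 / (x - e i))"
      unfolding sum_distrib_left
    proof (intro sum.cong refl)
      fix i assume "i \<in> {..<n}"
      thus "(\<Prod>j\<in>{..<n} - {i}. x - e j) = (\<Prod>i<n. x - e i) * (1 / (x - e i))"
        using ne[of i] by (subst prod.remove[of _ i]) auto
    qed
    finally have D: "poly (pderiv ?p) x = (\<Prod>i<n. x - e i) * (\<Sum>i<n. 1 / (x - e i))" .
    show ?thesis
      unfolding L by (simp add: euler_op_def D poly_prod algebra_simps)
  qed
  show ?thesis
  proof (rule ccontr)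
    assume "char_poly ?N \<noteq> euler_op n b ?p"
    hence "finite {x. poly (char_poly ?N - euler_op n b ?p) x = 0}"
      by (intro poly_roots_finite) simp
    moreover have "- e ` {..<n} \<subseteq> {x. poly (char_poly ?N - euler_op n b ?p) x = 0}"
      using pt by auto
    ultimately have "finite (- e ` {..<n})" by (rule rev_finite_subset)
    thus False using finite_compl[of "e ` {..<n}"] infinite_UNIV_char_0[where 'a = real] by simp
  qed
qed

section \<open>Matrices \<open>a I + c J\<close> with \<open>J\<close> the all-ones matrix\<close>

definition equi_mat :: "nat \<Rightarrow> real \<Rightarrow> real \<Rightarrow> real mat" where
  "equi_mat n a c = mat n n (\<lambda>(i, j). (if i = j then a else 0) + c)"

lemma equi_mat_carrier [simp]: "equi_mat n a c \<in> carrier_mat n n"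
  by (simp add: equi_mat_def)

lemma transpose_equi_mat [simp]: "transpose_mat (equi_mat n a c) = equi_mat n a c"
  by (auto simp: equi_mat_def)

text \<open>Since \<open>J * J = n J\<close>, the span of \<open>I\<close> and \<open>J\<close> is
  closed under products. The parameters are the coefficients of \<open>I\<close> and
  \<open>J\<close>, so the diagonal entries are \<open>a + c\<close>.\<close>

lemma equi_mat_mult:
  "equi_mat n a c * equi_mat n a' c' = equi_mat n (a * a') (a * c' + a' * c + n * c * c')"
proof (rule eq_matI)
  fix i j assume "i < dim_row (equi_mat n (a * a') (a * c' + a' * c + n * c * c'))"
    and "j < dim_col (equi_mat n (a * a') (a * c' + a' * c + n * c * c'))"
  hence ij: "i < n" "j < n" by (simp_all add: equi_mat_def)
  have "(equi_mat n a c * equi_mat n a' c') $$ (i, j) =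
      (\<Sum>k<n. ((if i = k then a else 0) + c) * ((if k = j then a' else 0) + c'))"
    using ij by (simp add: equi_mat_def scalar_prod_def atLeast0LessThan)
  also have "\<dots> = (\<Sum>k<n. if i = k then a * ((if k = j then a' else 0) + c') else 0)
      + (\<Sum>k<n. if k = j then c * a' else 0) + (\<Sum>k<n. c * c')"
    unfolding sum.distrib[symmetric] by (intro sum.cong) (auto simp: algebra_simps)
  also have "\<dots> = equi_mat n (a * a') (a * c' + a' * c + n * c * c') $$ (i, j)"
    using ij by (simp add: equi_mat_def sum.delta sum.delta' algebra_simps)
  finally show "(equi_mat n a c * equi_mat n a' c') $$ (i, j) =
      equi_mat n (a * a') (a * c' + a' * c + n * c * c') $$ (i, j)" .
qed (simp_all add: equi_mat_def)

text \<open>\<open>a I + c J\<close> acts as \<open>a + n c\<close> on the all-ones vector and as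
  \<open>a\<close> on its orthogonal complement. The bounds on \<open>\<alpha>\<close> make both
  eigenvalues of the Gram matrix positive; \<open>B\<close> has their square roots \<open>t\<close>
  and \<open>a\<close>.\<close>

lemma equi_mat_sqrt:
  assumes "\<alpha> < 1" "- 1 < (real n - 1) * \<alpha>" "n > 0"
  obtains B B' where "B \<in> carrier_mat n n" "transpose_mat B = B" "B * B = equi_mat n (1 - \<alpha>) \<alpha>"
    "B' \<in> carrier_mat n n" "B * B' = 1\<^sub>m n" "B' * B = 1\<^sub>m n"
proof -
  define a where "a = sqrt (1 - \<alpha>)"
  define t where "t = sqrt (1 - \<alpha> + n * \<alpha>)"
  define c where "c = (t - a) / n"
  have a: "a > 0" "a * a = 1 - \<alpha>" using assms by (auto simp: a_def)
  have "1 - \<alpha> + n * \<alpha> > 0" using assms by (simp add: algebra_simps)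
  hence t: "t > 0" "t * t = 1 - \<alpha> + n * \<alpha>" by (auto simp: t_def)
  have nc: "n * c = t - a" using assms by (simp add: c_def)
  \<comment> \<open>As \<open>a + n c = t\<close>, the coefficients of \<open>?B'\<close> are those
    with eigenvalues \<open>1 / a\<close> and \<open>1 / t\<close>.\<close>
  let ?B = "equi_mat n a c" and ?B' = "equi_mat n (1 / a) (- c / (a * t))"
  have "n * (a * c + a * c + n * c * c) = (a + a + n * c) * (n * c)" by (simp add: algebra_simps)
  also have "\<dots> = t * t - a * a" unfolding nc by (simp add: algebra_simps)
  also have "\<dots> = n * \<alpha>" using a t by simp
  finally have "a * c + a * c + n * c * c = \<alpha>" using assms by simp
  hence sq: "?B * ?B = equi_mat n (1 - \<alpha>) \<alpha>" by (simp add: equi_mat_mult a)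
  have "a * (- c / (a * t)) + (1 / a) * c + n * c * (- c / (a * t)) = 0"
    unfolding nc using a(1) t(1) by (simp add: field_simps)
  hence inv: "?B * ?B' = 1\<^sub>m n"
    using a by (simp add: equi_mat_mult) (auto simp: equi_mat_def)
  from that[OF _ _ sq _ inv mat_mult_left_right_inverse[OF _ _ inv]] show thesis by simp
qed

section \<open>Traces and the multiset of eigenvalues\<close>

lemma sum_diag_congruence_unit_cols:
  fixes S :: "real mat"
  assumes S: "S \<in> carrier_mat n n" and unit: "\<And>k. k < n \<Longrightarrow> col S k \<bullet> col S k = 1"
  shows "(\<Sum>i<n. (S * mat_diag n d * transpose_mat S) $$ (i, i)) = (\<Sum>k<n. d k)"
proof -
  have "(S * mat_diag n d * transpose_mat S) $$ (i, i) = (\<Sum>k<n. S $$ (i, k) * d k * S $$ (i, k))"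
    if "i < n" for i
    using S that by (simp add: mat_diag_mult_right[OF S] scalar_prod_def atLeast0LessThan)
  hence "(\<Sum>i<n. (S * mat_diag n d * transpose_mat S) $$ (i, i)) =
      (\<Sum>i<n. \<Sum>k<n. S $$ (i, k) * d k * S $$ (i, k))" by simp
  \<comment> \<open>With the sums exchanged, column \<open>k\<close> contributes \<open>d k\<close>
    times its squared norm.\<close>
  also have "\<dots> = (\<Sum>k<n. d k * (col S k \<bullet> col S k))"
    using S by (subst sum.swap) (auto intro!: sum.cong simp: scalar_prod_def atLeast0LessThan sum_distrib_left mult_ac)
  finally show ?thesis using unit by simp
qed

lemma gram_entry:
  assumes "S \<in> carrier_mat n n" "i < n" "j < n"
  shows "(transpose_mat S * S) $$ (i, j) = col S i \<bullet> col S j"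
  using assms by simp

lemma eigvals_eq:
  fixes n :: nat
  assumes "char_poly A = (\<Prod>i<n. [:- f i, 1:])"
  shows "eigvals A = image_mset f (mset_set {..<n})"
proof -
  have "eigvals A = (\<Sum>i<n. {#f i#})"
    unfolding eigvals_def assms by (subst proots_prod) auto
  also have "\<dots> = image_mset f (mset_set {..<n})"
    by (induction n) (auto simp: lessThan_Suc)
  finally show ?thesis .
qed

lemma sum_eigvals_eq:
  assumes A: "A \<in> carrier_mat n n" and sym: "transpose_mat A = A"
  shows "\<Sum>\<^sub># (eigvals A) = (\<Sum>i<n. A $$ (i, i))"
proof -
  obtain f where f: "char_poly A = (\<Prod>i<n. [:- f i, 1:])"
    using symmetric_char_poly_splits[OF A sym] by blast
  obtain P where P: "P \<in> carrier_mat n n" "transpose_mat P * P = 1\<^sub>m n"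
    "A = P * mat_diag n f * transpose_mat P"
    using orthogonal_diagonalization[OF A sym f] by blast
  have "col P k \<bullet> col P k = 1" if "k < n" for k
    using gram_entry[OF P(1) that that] P(2) that by simp
  from sum_diag_congruence_unit_cols[OF P(1) this, of f] show ?thesis
    unfolding P(3)[symmetric] by (simp add: eigvals_eq[OF f] sum_unfold_sum_mset)
qed

lemma char_poly_factor_zero_eigvals:
  assumes A: "A \<in> carrier_mat n n" and sym: "transpose_mat A = A"
    and simple: "\<And>x. x \<in># eigvals A \<Longrightarrow> x \<noteq> 0 \<Longrightarrow> count (eigvals A) x = 1"
  obtains k Z where "finite Z" "k + card Z = n"
    "char_poly A = monom 1 k * (\<Prod>r\<in>Z. [:- r, 1:])"
proof -
  obtain f where f: "char_poly A = (\<Prod>i<n. [:- f i, 1:])"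
    using symmetric_char_poly_splits[OF A sym] by blast
  let ?E = "eigvals A"
  define Z where "Z = set_mset ?E - {0}"
  have Z: "finite Z" by (simp add: Z_def)
  have "char_poly A = (\<Prod>x\<in>#?E. [:- x, 1:])"
    unfolding eigvals_eq[OF f] f by (simp add: prod_unfold_prod_mset image_mset.compositionality comp_def)
  \<comment> \<open>The index \<open>0\<close> is present even when it is not an eigenvalue; its
    factor is then a zeroth power.\<close>
  also have "\<dots> = (\<Prod>x\<in>insert 0 Z. [:- x, 1:] ^ count ?E x)"
    unfolding image_prod_mset_multiplicity
    by (intro prod.mono_neutral_left) (auto simp: Z_def not_in_iff)
  also have "\<dots> = [:0, 1:] ^ count ?E 0 * (\<Prod>x\<in>Z. [:- x, 1:] ^ count ?E x)"
    using Z by (subst prod.insert) (auto simp: Z_def)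
  also have "(\<Prod>x\<in>Z. [:- x, 1:] ^ count ?E x) = (\<Prod>x\<in>Z. [:- x, 1:])"
    using simple by (intro prod.cong) (auto simp: Z_def)
  finally have *: "char_poly A = monom 1 (count ?E 0) * (\<Prod>r\<in>Z. [:- r, 1:])"
    by (simp add: monom_altdef)
  have "n = degree (char_poly A)"
    using degree_monic_char_poly[OF A] by simp
  also have "\<dots> = count ?E 0 + card Z"
    unfolding * using prod_linear_monic[OF Z, of "\<lambda>r. r"]
    by (subst degree_mult_eq) (auto simp: degree_monom_eq prod_zero_iff Z)
  finally show thesis using that[OF Z _ *] by simp
qed

section \<open>Constructing \<open>S\<close> and the diagonal for a fixed
  \<open>\<alpha>\<close>\<close>

lemma EM_factorization:
  assumes A: "A \<in> carrier_mat n n" and sym: "transpose_mat A = A"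
    and \<alpha>: "\<alpha> < 1" "- 1 < (real n - 1) * \<alpha>" and n: "n > 0"
    and e: "euler_op n (\<alpha> / (1 - \<alpha>)) (\<Prod>i<n. [:- e i, 1:]) = char_poly A"
  shows "\<exists>S\<in>EM n \<alpha>. \<exists>d. A = S * mat_diag n d * transpose_mat S"
proof -
  obtain B B' where B: "B \<in> carrier_mat n n" "transpose_mat B = B" "B * B = equi_mat n (1 - \<alpha>) \<alpha>"
    "B' \<in> carrier_mat n n" "B * B' = 1\<^sub>m n" "B' * B = 1\<^sub>m n"
    using equi_mat_sqrt[OF \<alpha> n] by blast
  note assoc = assoc_mult_mat[of _ n n _ n _ n]
  \<comment> \<open>\<open>B * B\<close> is \<open>1 - \<alpha>\<close> times \<open>I + b J\<close>
    with \<open>b = \<alpha> / (1 - \<alpha>)\<close>. Dividing by that scalar here makes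
    \<open>?D * (B * B)\<close> equal to \<open>diag(e)\<close> times
    \<open>I + b J\<close>.\<close>
  define d where "d i = e i / (1 - \<alpha>)" for i
  let ?D = "mat_diag n d"
  have carr: "?D \<in> carrier_mat n n" by simp
  have D: "transpose_mat ?D = ?D" by (auto simp: mat_diag_def)
  define M where "M = B * ?D * B"
  have M: "M \<in> carrier_mat n n"
    unfolding M_def using B carr by (auto intro!: mult_carrier_mat[of _ n n])
  have Msym: "transpose_mat M = M"
    using B D carr by (simp add: M_def transpose_mult[of _ n n _ n] assoc del: mat_diag_dim)
  have "?D * (B * B) = mat n n (\<lambda>(i, j). e i * ((if i = j then 1 else 0) + \<alpha> / (1 - \<alpha>)))"
    unfolding B(3) using \<alpha>(1)
    by (subst mat_diag_mult_left[of _ n n]) (auto simp: equi_mat_def d_def field_simps)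
  hence "char_poly A = char_poly (?D * (B * B))"
    by (simp add: e char_poly_diag_mult_one_plus_const)
  \<comment> \<open>Conjugation by \<open>B\<close> moves one factor \<open>B\<close> to the front,
    replacing the product by the symmetric matrix \<open>M\<close>.\<close>
  also have "\<dots> = char_poly M"
  proof (rule char_poly_similar, rule similar_matI[of _ _ B' B n])
    show "?D * (B * B) = B' * M * B"
    proof -
      have "B' * M * B = (B' * B) * (?D * (B * B))"
        using B(1,4) carr by (simp add: M_def assoc del: mat_diag_dim)
      also have "\<dots> = ?D * (B * B)" unfolding B(6) using B(1) carr
          by (intro left_mult_one_mat[of _ n n] mult_carrier_mat[of _ n n])
      finally show ?thesis ..
    qed
  qed (use B M carr in \<open>auto intro!: mult_carrier_mat[of _ n n]\<close>)
  finally have cp: "char_poly A = char_poly M" .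
  obtain f where f: "char_poly A = (\<Prod>i<n. [:- f i, 1:])"
    using symmetric_char_poly_splits[OF A sym] by blast
  note carr = carr mat_diag_dim[of n f]
  obtain P where P: "P \<in> carrier_mat n n" "transpose_mat P * P = 1\<^sub>m n"
    "A = P * mat_diag n f * transpose_mat P"
    using orthogonal_diagonalization[OF A sym f] by blast
  obtain Q where Q: "Q \<in> carrier_mat n n" "transpose_mat Q * Q = 1\<^sub>m n"
    "M = Q * mat_diag n f * transpose_mat Q"
    using orthogonal_diagonalization[OF M Msym] f cp by metis
  have QQ: "Q * transpose_mat Q = 1\<^sub>m n"
    by (rule mat_mult_left_right_inverse[OF _ Q(1,2)]) (use Q in simp)
  \<comment> \<open>\<open>A\<close> and \<open>M\<close> were diagonalized with the same
    \<open>f\<close>, so this orthogonal matrix carries \<open>M\<close> to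
    \<open>A\<close>.\<close>
  define U where "U = P * transpose_mat Q"
  have U: "U \<in> carrier_mat n n" and UT: "transpose_mat U = Q * transpose_mat P"
    using P Q by (auto simp: U_def transpose_mult[of _ n n _ n])
  have "transpose_mat U * U = Q * (transpose_mat P * P) * transpose_mat Q"
    unfolding UT unfolding U_def using P(1) Q(1) carr by (simp add: assoc del: mat_diag_dim)
  hence UU: "transpose_mat U * U = 1\<^sub>m n" using P(2) Q(1) QQ by simp
  have "U * M * transpose_mat U =
      P * (transpose_mat Q * Q) * mat_diag n f * (transpose_mat Q * Q) * transpose_mat P"
    unfolding UT unfolding U_def Q(3) using P(1) Q(1) carr by (simp add: assoc del: mat_diag_dim)
  hence AU: "A = U * M * transpose_mat U"
    unfolding Q(2) using P by (simp add: right_mult_one_mat[OF mult_carrier_mat[OF P(1) carr(2)]])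
  define S where "S = U * B"
  have S: "S \<in> carrier_mat n n" and ST: "transpose_mat S = B * transpose_mat U"
    using U B by (auto simp: S_def transpose_mult[of _ n n _ n])
  have "transpose_mat S * S = B * (transpose_mat U * U) * B"
    unfolding ST unfolding S_def using U B(1) carr by (simp add: assoc del: mat_diag_dim)
  hence SS: "transpose_mat S * S = equi_mat n (1 - \<alpha>) \<alpha>" using UU B by simp
  have "B' * transpose_mat U * S = B' * (transpose_mat U * U) * B"
    unfolding S_def using U B(1,4) carr by (simp add: assoc del: mat_diag_dim)
  hence inv: "(B' * transpose_mat U) * S = 1\<^sub>m n" using UU B by simp
  have inv': "S * (B' * transpose_mat U) = 1\<^sub>m n"
    by (rule mat_mult_left_right_inverse[OF _ S inv]) (use B U in simp)
  have "invertible_mat S"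
    unfolding invertible_mat_def inverts_mat_def using S U B inv inv'
    by (intro conjI exI[of _ "B' * transpose_mat U"]) auto
  moreover have "col S i \<bullet> col S j = (if i = j then 1 else \<alpha>)" if "i < n" "j < n" for i j
    using gram_entry[OF S that] that unfolding SS by (cases "i = j") (simp_all add: equi_mat_def)
  ultimately have "S \<in> EM n \<alpha>" using S by (simp add: EM_def)
  moreover have "A = S * ?D * transpose_mat S"
    unfolding ST unfolding AU M_def S_def using U B(1) carr by (simp add: assoc del: mat_diag_dim)
  ultimately show ?thesis by blast
qed

theorem theorem3p5:
  fixes A :: "real mat" and n :: nat
  assumes "n \<ge> 2"
    and "A \<in> carrier_mat n n"
    and "transpose_mat A = A"
    and "count (eigvals A) 0 \<le> n - 2"
    and "\<And>x. x \<in># eigvals A \<Longrightarrow> x \<noteq> 0 \<Longrightarrow> count (eigvals A) x = 1"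
  shows "\<exists>U. open U \<and> 0 \<in> U \<and> U \<subseteq> {-1 / (real n - 1)<..<1} \<and>
    (\<forall>\<alpha>\<in>U.
      (\<exists>S\<in>EM n \<alpha>. \<exists>d. A = S * mat_diag n d * transpose_mat S) \<and>
      (\<forall>S\<in>EM n \<alpha>. \<forall>d. A = S * mat_diag n d * transpose_mat S \<longrightarrow>
        (\<Sum>i<n. d i) = \<Sum>\<^sub># (eigvals A)))"
proof -
  note n = assms(1) and A = assms(2) and sym = assms(3)
  obtain k Z where kZ: "finite Z" "k + card Z = n"
    "char_poly A = monom 1 k * (\<Prod>r\<in>Z. [:- r, 1:])"
    using char_poly_factor_zero_eigvals[OF A sym assms(5)] by blast
  \<comment> \<open>The parameter \<open>b = \<alpha> / (1 - \<alpha>)\<close> tends to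
    \<open>0\<close> with \<open>\<alpha>\<close>, so what holds for small \<open>b\<close> holds
    for small \<open>\<alpha>\<close>.\<close>
  have "((\<lambda>\<alpha>::real. \<alpha> / (1 - \<alpha>)) \<longlongrightarrow> 0 / (1 - 0)) (nhds 0)"
    by (intro tendsto_intros) (auto intro: filterlim_ident)
  hence "filterlim (\<lambda>\<alpha>::real. \<alpha> / (1 - \<alpha>)) (nhds 0) (nhds 0)"
    by simp
  from eventually_compose_filterlim[OF eventually_euler_op_preimage[OF kZ(3,1,2)] this]
  have "\<forall>\<^sub>F \<alpha> in nhds (0::real). \<exists>e. euler_op n (\<alpha> / (1 - \<alpha>)) (\<Prod>i<n. [:- e i, 1:]) = char_poly A" .
  then obtain V where V: "open V" "0 \<in> V"
    "\<And>\<alpha>. \<alpha> \<in> V \<Longrightarrow> \<exists>e. euler_op n (\<alpha> / (1 - \<alpha>)) (\<Prod>i<n. [:- e i, 1:]) = char_poly A"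
    unfolding eventually_nhds by blast
  \<comment> \<open>The interval keeps the prescribed Gram matrix positive definite, as its square
    root requires.\<close>
  define U where "U = V \<inter> {-1 / (real n - 1)<..<1}"
  have "\<exists>S\<in>EM n \<alpha>. \<exists>d. A = S * mat_diag n d * transpose_mat S" if "\<alpha> \<in> U" for \<alpha>
  proof -
    have "\<alpha> < 1" "- 1 < (real n - 1) * \<alpha>"
      using that n by (auto simp: U_def field_simps)
    with V(3)[of \<alpha>] that n show ?thesis
      using EM_factorization[OF A sym] by (auto simp: U_def)
  qed
  \<comment> \<open>The trace argument covers every factorization of this form, not only the
    constructed one.\<close>
  moreover have "(\<Sum>i<n. d i) = \<Sum>\<^sub># (eigvals A)"
    if S: "S \<in> EM n \<alpha>" and AS: "A = S * mat_diag n d * transpose_mat S" for S \<alpha> d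
    proof -
    have "(\<Sum>i<n. (S * mat_diag n d * transpose_mat S) $$ (i, i)) = (\<Sum>i<n. d i)"
      using S by (intro sum_diag_congruence_unit_cols) (auto simp: EM_def)
    thus ?thesis
      unfolding sum_eigvals_eq[OF A sym] AS[symmetric] by (rule HOL.sym)
  qed
  moreover have "open U" "0 \<in> U" "U \<subseteq> {-1 / (real n - 1)<..<1}"
    using V n by (auto simp: U_def)
  ultimately show ?thesis by blast
qed

end
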